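(* Let $f:[0,\infty)\to[0,\infty)$, $K>0$ and $M\ge 1$ satisfy Assumption A (stated in the context). Let $M_\varepsilon>1$ and $\varepsilon\in(0,K)$ be constants for which $$|f(x)-K|\le M_\varepsilon|x-K|,\qquad x\in(K-\varepsilon,K+\varepsilon),$$ and let $\alpha\in\left(1-\frac1{M_\varepsilon},1\right)$. Suppose that $\{\xi_n\}$ satisfies Assumption N (stated in the context) with parameter $\nu\ge1$, and that $l>0$ satisfies $$l<\min\left\{\alpha-\left(1-\frac1{M_\varepsilon}\right),\ \frac{1-\alpha}{\nu}\right\}.$$ Let $\{x_n\}_{n\in\mathbb{N}_0}$ be any solution of $$x_{n+1}=\max\left\{f(x_n)-(\alpha+l\xi_{n+1})(f(x_n)-x_n),\,0\right\},\qquad n\in\mathbb{N}_0,$$ with $x_0>0$. Then the following is true for all $\omega\in\Omega$: if $x_j(\omega)\in(K-\varepsilon,K+\varepsilon)$ for some $j\in\mathbb{N}_0$, then $x_n(\omega)\in(K-\varepsilon,K+\varepsilon)$ for every $n\ge j$ and $$\lim_{n\to\infty}x_n(\omega)=K.$$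
   Context: $\mathbb{N}_0=\{0,1,2,\dots\}$. Assumption A: $f:[0,\infty)\to[0,\infty)$ is a continuous function, $f(x)>0$ for $x>0$, $f(x)>x$ for $x\in(0,K)$, $f(x)<x$ for $x>K$, and $M\ge1$ is a constant such that $|f(x)-K|\le M|x-K|$ for all $x\ge 0$. (Hence $K>0$ is the unique positive fixed point of $f$.) Probabilistic setting: $(\Omega,\mathcal F,\{\mathcal F_n\},\mathbb P)$ is a complete filtered probability space whose filtration is the one generated by the sequence $\{\xi_n\}$, and $x_0$ is a deterministic initial value. Assumption N (with parameter $\nu\ge1$): $\{\xi_n\}$ is a sequence of independent identically distributed continuous random variables with common density function $\phi$ whose support is the interval $[-1,\nu]$; $\xi_n(\omega)\in[-1,\nu]$ for all $n$ and all $\omega\in\Omega$, and every nondegenerate subinterval of $[-1,\nu]$ has positive probability under the law of $\xi_n$. *)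

theory Defs
  imports "HOL-Probability.Probability"
begin

text \<open>Functions on \<open>[0,\<infinity>)\<close> are modelled by functions on the reals that are constrained only on
  the nonnegative half-line.\<close>

definition assumption_A :: "(real \<Rightarrow> real) \<Rightarrow> real \<Rightarrow> real \<Rightarrow> bool" where
  "assumption_A f K M \<longleftrightarrow>
     f \<in> {0..} \<rightarrow> {0..} \<and> continuous_on {0..} f \<and>
     (\<forall>x>0. f x > 0) \<and>
     (\<forall>x\<in>{0<..<K}. f x > x) \<and>
     (\<forall>x>K. f x < x) \<and>
     M \<ge> 1 \<and> (\<forall>x\<ge>0. \<bar>f x - K\<bar> \<le> M * \<bar>x - K\<bar>)"

text \<open>The noise is the sequence \<open>\<xi> 1, \<xi> 2, \<dots>\<close>; the value \<open>\<xi> 0\<close> never plays a role. The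
  \<open>n\<close>-th \<open>\<sigma>\<close>-algebra is generated by \<open>\<xi> 1, \<dots>, \<xi> n\<close>, so it is trivial for \<open>n = 0\<close>. Of the
  measures \<open>F n\<close> only the \<open>\<sigma>\<close>-algebra matters. Completeness refers to the probability
  measure \<open>P\<close>.\<close>

definition filtered_space_generated_by ::
    "'a measure \<Rightarrow> (nat \<Rightarrow> 'a measure) \<Rightarrow> (nat \<Rightarrow> 'a \<Rightarrow> real) \<Rightarrow> bool" where
  "filtered_space_generated_by P F \<xi> \<longleftrightarrow>
     prob_space P \<and> complete_measure P \<and>
     filtration (space P) F \<and> (\<forall>n. subalgebra P (F n)) \<and>
     (\<forall>n. sets (F n) =
        sigma_sets (space P) {\<xi> i -` B \<inter> space P |i B. i \<in> {1..n} \<and> B \<in> sets borel})"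

text \<open>Identical distribution is expressed by the common density \<open>\<phi>\<close>. A density is determined only
  up to null sets; the support condition is on the chosen version.\<close>

definition assumption_N ::
    "'a measure \<Rightarrow> (nat \<Rightarrow> 'a \<Rightarrow> real) \<Rightarrow> (real \<Rightarrow> real) \<Rightarrow> real \<Rightarrow> bool" where
  "assumption_N P \<xi> \<phi> \<nu> \<longleftrightarrow>
     \<nu> \<ge> 1 \<and>
     prob_space.indep_vars P (\<lambda>_. borel) \<xi> {1..} \<and>
     (\<forall>y. \<phi> y \<ge> 0) \<and>
     (\<forall>n\<ge>1. distributed P lborel (\<xi> n) (\<lambda>y. ennreal (\<phi> y))) \<and>
     closure {y. \<phi> y \<noteq> 0} = {-1..\<nu>} \<and>
     (\<forall>n\<ge>1. \<forall>\<omega>\<in>space P. \<xi> n \<omega> \<in> {-1..\<nu>}) \<and>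
     (\<forall>n\<ge>1. \<forall>I. is_interval I \<and> I \<subseteq> {-1..\<nu>} \<and> (\<exists>a\<in>I. \<exists>b\<in>I. a < b) \<longrightarrow>
        measure (distr P borel (\<xi> n)) I > 0)"

end

theory Submission
  imports Defs
begin

text \<open>The result is pathwise: on every path the coefficient \<open>c = \<alpha> + l \<xi>\<close> stays in a fixed interval
  \<open>[a, b]\<close> with \<open>1 - 1/M\<^sub>\<epsilon> < a\<close> and \<open>b < 1\<close>. Up to truncation at zero, one step replaces \<open>y\<close> by
  the convex combination \<open>(1 - c) f y + c y\<close>. Relative to \<open>K\<close> there are two cases.
  If \<open>f y\<close> overshoots \<open>K\<close>, then the two parts of the combination pull in opposite directions, and
  the bounds \<open>(1 - c) M\<^sub>\<epsilon> \<le> (1 - a) M\<^sub>\<epsilon> < 1\<close> and \<open>c \<le> b < 1\<close> on them make the step a contraction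
  with the fixed factor \<open>q = max b ((1 - a) M\<^sub>\<epsilon>)\<close>. If \<open>f y\<close> lies between \<open>y\<close> and \<open>K\<close>, then so
  does the new point, and the distance to \<open>K\<close> drops by
  \<open>(1 - c) \<bar>f y - y\<bar> \<ge> (1 - b) \<bar>f y - y\<bar>\<close>; here a uniform contraction factor need not exist, since
  \<open>\<bar>f y - y\<bar>\<close> may be much smaller than \<open>\<bar>y - K\<bar>\<close> near \<open>K\<close>.

  In both cases (lemma \<open>convex_step_decrease\<close>) the distance to \<open>K\<close> decreases by at least
  \<open>g y = min ((1 - q) \<bar>y - K\<bar>) ((1 - b) \<bar>f y - y\<bar>)\<close>. This gives invariance of the
  neighbourhood at once. For the limit, the distances decrease and therefore converge, so \<open>g\<close> tends to
  zero along the path; \<open>g\<close> is continuous and vanishes only at \<open>K\<close>, so compactness forces the path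
  to \<open>K\<close> (lemma \<open>descent_tendsto\<close>).\<close>

text \<open>Away from \<open>p\<close> the function \<open>h\<close> is bounded away from zero by compactness, so a sequence along
  which \<open>h\<close> tends to zero cannot keep returning there.\<close>

lemma tendsto_unique_zero_compact:
  fixes h :: "'a::metric_space \<Rightarrow> real"
  assumes "compact S" and h: "continuous_on S h"
    and zero: "\<And>y. y \<in> S \<Longrightarrow> h y = 0 \<Longrightarrow> y = p"
    and X: "\<And>n. X n \<in> S" and lim: "(\<lambda>n. h (X n)) \<longlonglongrightarrow> 0"
  shows "X \<longlonglongrightarrow> p"
proof (rule tendstoI)
  fix e :: real
  assume "e > 0"
  let ?T = "S - ball p e"
  show "\<forall>\<^sub>F n in sequentially. dist (X n) p < e"
  proof (cases "?T = {}")
    case True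
    then have "dist (X n) p < e" for n
      using X[of n] by (auto simp: dist_commute)
    then show ?thesis by simp
  next
    case False
    have "compact ?T"
      using \<open>compact S\<close> by (intro compact_diff) auto
    moreover have "continuous_on ?T (\<lambda>y. \<bar>h y\<bar>)"
      by (intro continuous_intros continuous_on_subset[OF h]) auto
    ultimately obtain z where z: "z \<in> ?T" "\<And>y. y \<in> ?T \<Longrightarrow> \<bar>h z\<bar> \<le> \<bar>h y\<bar>"
      using continuous_attains_inf[of ?T "\<lambda>y. \<bar>h y\<bar>"] False by blast
    have "h z \<noteq> 0"
      using z(1) zero[of z] \<open>e > 0\<close> by auto
    then have "\<forall>\<^sub>F n in sequentially. \<bar>h (X n)\<bar> < \<bar>h z\<bar>"
      using tendstoD[OF lim, of "\<bar>h z\<bar>"] by (simp add: dist_real_def)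
    then show ?thesis
    proof eventually_elim
      case (elim n)
      then have "X n \<notin> ?T"
        using z(2)[of "X n"] by linarith
      then show ?case
        using X[of n] by (auto simp: dist_commute)
    qed
  qed
qed

text \<open>A discrete Lyapunov argument: the decrements of a decreasing sequence bounded below tend to
  zero, and they dominate \<open>g\<close>.\<close>

lemma descent_tendsto:
  fixes g :: "'a::metric_space \<Rightarrow> real"
  assumes "compact S" and "continuous_on S g"
    and nonneg: "\<And>y. g y \<ge> 0" and zero: "\<And>y. y \<in> S \<Longrightarrow> g y = 0 \<Longrightarrow> y = p"
    and X: "\<And>n. X n \<in> S"
    and step: "\<And>n. dist (X (Suc n)) p \<le> dist (X n) p - g (X n)"
  shows "X \<longlonglongrightarrow> p"
proof -
  have "decseq (\<lambda>n. dist (X n) p)"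
    using step nonneg by (intro decseq_SucI) (smt (verit))
  then obtain d where d: "(\<lambda>n. dist (X n) p) \<longlonglongrightarrow> d"
    using decseq_convergent[of "\<lambda>n. dist (X n) p" 0] by auto
  have "(\<lambda>n. dist (X n) p - dist (X (Suc n)) p) \<longlonglongrightarrow> d - d"
    by (intro tendsto_diff d LIMSEQ_Suc)
  then have decrement: "(\<lambda>n. dist (X n) p - dist (X (Suc n)) p) \<longlonglongrightarrow> 0"
    by simp
  have "(\<lambda>n. g (X n)) \<longlonglongrightarrow> 0"
  proof (rule tendsto_sandwich[OF _ _ tendsto_const decrement])
    show "\<forall>\<^sub>F n in sequentially. g (X n) \<le> dist (X n) p - dist (X (Suc n)) p"
      using step by (simp add: algebra_simps)
  qed (simp add: nonneg)
  with assms(1,2) zero X show ?thesis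
    by (rule tendsto_unique_zero_compact)
qed

text \<open>Here \<open>u\<close> and \<open>v\<close> stand for \<open>y - K\<close> and \<open>f y - K\<close>. The first term of the minimum is
  responsible for \<open>u\<close> and \<open>v\<close> of opposite signs, the second for equal signs.\<close>

lemma convex_step_decrease_pos:
  fixes u v :: real
  assumes u: "u > 0" and "v \<le> u" and lip: "\<bar>v\<bar> \<le> L * u" and "L \<ge> 0"
    and c: "0 \<le> c" "a \<le> c" "c \<le> b" "b \<le> 1" and q: "b \<le> q" "(1 - a) * L \<le> q"
  shows "\<bar>(1 - c) * v + c * u\<bar> \<le> u - min ((1 - q) * u) ((1 - b) * (u - v))"
proof (cases "v \<ge> 0")
  case True
  have "(1 - b) * (u - v) \<le> (1 - c) * (u - v)"
    using c \<open>v \<le> u\<close> by (intro mult_right_mono) auto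
  moreover have "(1 - c) * v + c * u \<ge> 0"
    using True c u by simp
  ultimately show ?thesis
    by (simp add: algebra_simps)
next
  case False
  have upper: "c * u \<le> q * u"
    using c q u by (intro mult_right_mono) auto
  have "(1 - c) * (- v) \<le> (1 - c) * (L * u)"
    using lip c by (intro mult_left_mono) auto
  also have "\<dots> \<le> (1 - a) * (L * u)"
    using c u \<open>L \<ge> 0\<close> by (intro mult_right_mono) auto
  also have "\<dots> \<le> q * u"
    using q u by (simp add: mult.assoc[symmetric] mult_right_mono)
  finally have lower: "(1 - c) * (- v) \<le> q * u" .
  have "(1 - c) * (- v) \<ge> 0"
    using False c by (intro mult_nonneg_nonneg) auto
  moreover have "c * u \<ge> 0"
    using c u by simp
  ultimately have "\<bar>(1 - c) * v + c * u\<bar> \<le> q * u"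
    using upper lower by (simp add: abs_le_iff)
  then show ?thesis
    by (simp add: algebra_simps)
qed

lemma convex_step_decrease:
  fixes u v :: real
  assumes "u > 0 \<Longrightarrow> v \<le> u" and "u < 0 \<Longrightarrow> u \<le> v" and "\<bar>v\<bar> \<le> L * \<bar>u\<bar>" and "L \<ge> 0"
    and "0 \<le> c" "a \<le> c" "c \<le> b" "b \<le> 1" and "b \<le> q" "(1 - a) * L \<le> q"
  shows "\<bar>(1 - c) * v + c * u\<bar> \<le> \<bar>u\<bar> - min ((1 - q) * \<bar>u\<bar>) ((1 - b) * \<bar>v - u\<bar>)"
proof -
  consider "u > 0" | "u = 0" | "u < 0" by linarith
  then show ?thesis
  proof cases
    case 1
    then show ?thesis
      using convex_step_decrease_pos[of u v L c a b q] assms by simp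
  next
    case 2
    then show ?thesis
      using assms(3) by simp
  next
    case 3
    have "\<bar>(1 - c) * (- v) + c * (- u)\<bar> = \<bar>(1 - c) * v + c * u\<bar>"
      using abs_minus_cancel[of "(1 - c) * v + c * u"] by simp
    then show ?thesis
      using convex_step_decrease_pos[of "- u" "- v" L c a b q] assms 3 by simp
  qed
qed

theorem lemma3p8:
  fixes f :: "real \<Rightarrow> real" and K M M\<^sub>\<epsilon> \<epsilon> \<alpha> l \<nu> x\<^sub>0 :: real
    and P :: "'a measure" and F :: "nat \<Rightarrow> 'a measure"
    and \<xi> :: "nat \<Rightarrow> 'a \<Rightarrow> real" and \<phi> :: "real \<Rightarrow> real"
    and x :: "nat \<Rightarrow> 'a \<Rightarrow> real"
  assumes "K > 0" and "M \<ge> 1" and "assumption_A f K M"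
    and "M\<^sub>\<epsilon> > 1" and "\<epsilon> \<in> {0<..<K}"
    and "\<forall>y\<in>{K - \<epsilon><..<K + \<epsilon>}. \<bar>f y - K\<bar> \<le> M\<^sub>\<epsilon> * \<bar>y - K\<bar>"
    and "\<alpha> \<in> {1 - 1 / M\<^sub>\<epsilon><..<1}"
    and "filtered_space_generated_by P F \<xi>"
    and "assumption_N P \<xi> \<phi> \<nu>"
    and "l > 0" and "l < min (\<alpha> - (1 - 1 / M\<^sub>\<epsilon>)) ((1 - \<alpha>) / \<nu>)"
    and "x\<^sub>0 > 0" and "\<forall>\<omega>\<in>space P. x 0 \<omega> = x\<^sub>0"
    and "\<forall>\<omega>\<in>space P. \<forall>n. x (Suc n) \<omega> =
           max (f (x n \<omega>) - (\<alpha> + l * \<xi> (Suc n) \<omega>) * (f (x n \<omega>) - x n \<omega>)) 0"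
  shows "\<forall>\<omega>\<in>space P. \<forall>j. x j \<omega> \<in> {K - \<epsilon><..<K + \<epsilon>} \<longrightarrow>
           (\<forall>n\<ge>j. x n \<omega> \<in> {K - \<epsilon><..<K + \<epsilon>}) \<and> (\<lambda>n. x n \<omega>) \<longlonglongrightarrow> K"
proof (intro ballI allI impI)
  fix \<omega> j
  assume \<omega>: "\<omega> \<in> space P" and j: "x j \<omega> \<in> {K - \<epsilon><..<K + \<epsilon>}"
  have f_cont: "continuous_on {0..} f"
    and f_above: "\<And>y. 0 < y \<Longrightarrow> y < K \<Longrightarrow> f y > y" and f_below: "\<And>y. y > K \<Longrightarrow> f y < y"
    using assms(3) unfolding assumption_A_def by auto
  have \<nu>: "\<nu> \<ge> 1" and \<xi>: "\<And>n. \<xi> (Suc n) \<omega> \<in> {-1..\<nu>}"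
    using assms(9) \<omega> unfolding assumption_N_def by auto
  define a b where "a = \<alpha> - l" and "b = \<alpha> + l * \<nu>"
  define q where "q = max b ((1 - a) * M\<^sub>\<epsilon>)"
  have a: "1 - 1 / M\<^sub>\<epsilon> < a"
    using assms(11) by (simp add: a_def)
  have "0 < 1 - 1 / M\<^sub>\<epsilon>"
    using assms(4) by simp
  with a have "0 < a"
    by linarith
  have "b < 1"
    using assms(11) \<nu> by (simp add: b_def field_simps)
  have "(1 - a) * M\<^sub>\<epsilon> < 1 / M\<^sub>\<epsilon> * M\<^sub>\<epsilon>"
    using a assms(4) by (intro mult_strict_right_mono) auto
  with \<open>b < 1\<close> assms(4) have "q < 1"
    by (simp add: q_def)
  have coeff: "a \<le> \<alpha> + l * \<xi> (Suc n) \<omega>" "\<alpha> + l * \<xi> (Suc n) \<omega> \<le> b" for n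
  proof -
    have "l * (-1) \<le> l * \<xi> (Suc n) \<omega>" "l * \<xi> (Suc n) \<omega> \<le> l * \<nu>"
      by (rule mult_left_mono; use \<xi>[of n] assms(10) in simp)+
    then show "a \<le> \<alpha> + l * \<xi> (Suc n) \<omega>" "\<alpha> + l * \<xi> (Suc n) \<omega> \<le> b"
      by (auto simp: a_def b_def)
  qed
  define g where "g y = min ((1 - q) * \<bar>y - K\<bar>) ((1 - b) * \<bar>f y - y\<bar>)" for y
  have g_nonneg: "g y \<ge> 0" for y
    using \<open>q < 1\<close> \<open>b < 1\<close> by (simp add: g_def)
  have descent: "dist (x (Suc n) \<omega>) K \<le> dist (x n \<omega>) K - g (x n \<omega>)"
    if n: "x n \<omega> \<in> {K - \<epsilon><..<K + \<epsilon>}" for n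
  proof -
    define y c where "y = x n \<omega>" and "c = \<alpha> + l * \<xi> (Suc n) \<omega>"
    have y: "y \<in> {K - \<epsilon><..<K + \<epsilon>}" "y > 0"
      using n assms(5) by (auto simp: y_def)
    have "x (Suc n) \<omega> = max (f y - c * (f y - y)) 0"
      using assms(14) \<omega> by (simp add: y_def c_def)
    \<comment> \<open>Truncation at \<open>0 < K\<close> can only bring the point closer to \<open>K\<close>.\<close>
    then have "\<bar>x (Suc n) \<omega> - K\<bar> \<le> \<bar>f y - c * (f y - y) - K\<bar>"
      using assms(1) by auto
    also have "f y - c * (f y - y) - K = (1 - c) * (f y - K) + c * (y - K)"
      by (simp add: algebra_simps)
    also have "\<bar>\<dots>\<bar> \<le> \<bar>y - K\<bar> - min ((1 - q) * \<bar>y - K\<bar>) ((1 - b) * \<bar>f y - K - (y - K)\<bar>)"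
    proof (rule convex_step_decrease[where a = a and L = M\<^sub>\<epsilon>])
      show "y - K > 0 \<Longrightarrow> f y - K \<le> y - K" "y - K < 0 \<Longrightarrow> y - K \<le> f y - K"
        using f_above[of y] f_below[of y] y by auto
      show "\<bar>f y - K\<bar> \<le> M\<^sub>\<epsilon> * \<bar>y - K\<bar>"
        using assms(6) y by blast
      show "0 \<le> c" "a \<le> c" "c \<le> b"
        using coeff[of n] \<open>0 < a\<close> by (auto simp: c_def)
    qed (use assms(4) \<open>b < 1\<close> in \<open>auto simp: q_def\<close>)
    finally show ?thesis
      by (simp add: g_def y_def dist_real_def)
  qed
  define r where "r = dist (x j \<omega>) K"
  have r: "r < \<epsilon>"
    using j by (auto simp: r_def dist_real_def)
  have near: "x n \<omega> \<in> {K - \<epsilon><..<K + \<epsilon>}" if "dist (x n \<omega>) K \<le> r" for n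
    using that r by (auto simp: dist_real_def)
  have closer: "dist (x n \<omega>) K \<le> r" if "n \<ge> j" for n
    using that
  proof (induction rule: dec_induct)
    case base
    then show ?case by (simp add: r_def)
  next
    case (step n)
    then show ?case
      using descent[OF near[OF step.IH]] g_nonneg[of "x n \<omega>"]
      by linarith
  qed
  have "(\<lambda>n. x (n + j) \<omega>) \<longlonglongrightarrow> K"
  proof (rule descent_tendsto)
    \<comment> \<open>The closed interval of radius \<open>r\<close> is compact and, as \<open>r < \<epsilon> < K\<close>, lies in the domain
      \<open>y > 0\<close> where \<open>f\<close> is continuous and has no fixed point but \<open>K\<close>.\<close>
    have pos: "cball K r \<subseteq> {0<..}"
      using r assms(5) by (auto simp: dist_real_def)
    then have "continuous_on (cball K r) f"
      by (intro continuous_on_subset[OF f_cont]) force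
    then show "continuous_on (cball K r) g"
      unfolding g_def by (intro continuous_intros)
    show "y = K" if "y \<in> cball K r" "g y = 0" for y
    proof (rule ccontr)
      assume "y \<noteq> K"
      then have "f y \<noteq> y"
        using pos that(1) f_above[of y] f_below[of y] by (cases "y < K") auto
      with \<open>y \<noteq> K\<close> have "g y > 0"
        using \<open>q < 1\<close> \<open>b < 1\<close> by (simp add: g_def)
      with that(2) show False by simp
    qed
    show "x (n + j) \<omega> \<in> cball K r" for n
      using closer[of "n + j"] by (simp add: dist_commute)
    show "dist (x (Suc n + j) \<omega>) K \<le> dist (x (n + j) \<omega>) K - g (x (n + j) \<omega>)" for n
      using descent[OF near[OF closer[of "n + j"]]] by simp
  qed (auto simp: g_nonneg)
  then have "(\<lambda>n. x n \<omega>) \<longlonglongrightarrow> K"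
    by (rule LIMSEQ_offset)
  with near[OF closer]
  show "(\<forall>n\<ge>j. x n \<omega> \<in> {K - \<epsilon><..<K + \<epsilon>}) \<and> (\<lambda>n. x n \<omega>) \<longlonglongrightarrow> K"
    by blast
qed

end
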